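(* Let $T>0$, $0<\alpha<\frac12$, and let $f:[0,T]^2\to\mathbb R^d$ be a measurable function such that, for some $L>0$ and $\mu>\alpha$, $|f(t_1,s)-f(t_2,s)|\le L|t_1-t_2|^\mu$ for all $0<s\le t_1,t_2\le T$. Put $F_t(f)=\int_0^t f(t,s)\,ds$. If $$\sup_{t\in[0,T]}\int_0^t\frac{|f(t,s)|}{(t-s)^\alpha}ds<\infty,$$ then $F_\cdot(f)\in W_0^{\alpha,\infty}(0,T;\mathbb R^d)$ and there exist constants $C^{(1)}_{\alpha,T}$, depending only on $\alpha,T$, and $C^{(2)}_{\alpha,L,\mu}$, depending only on $\alpha,L,\mu$, such that for all $t\in[0,T]$ $$|F_t(f)|+\int_0^t\frac{|F_t(f)-F_s(f)|}{(t-s)^{\alpha+1}}ds\le C^{(1)}_{\alpha,T}\int_0^t\frac{|f(t,s)|}{(t-s)^\alpha}ds+C^{(2)}_{\alpha,L,\mu}\,t^{1+\mu-\alpha}.$$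
   Context: $W_0^{\alpha,\infty}(0,T;\mathbb R^d)$ is the space of measurable $h:[0,T]\to\mathbb R^d$ with $\|h\|_{\alpha,\infty}:=\sup_{t\in[0,T]}\big(|h(t)|+\int_0^t\frac{|h(t)-h(s)|}{(t-s)^{\alpha+1}}ds\big)<\infty$. *)

theory Defs
  imports "HOL-Analysis.Analysis"
begin

text \<open>
  The space R^d is rendered as \<^term>\<open>topspace (Euclidean_space d)\<close>, the sequences
  vanishing from index d on, so that d is a variable of the logic: constants can
  then be asserted to be independent of d.  The ambient sigma-algebra is the Borel
  algebra of the product topology on \<^typ>\<open>nat \<Rightarrow> real\<close>, which induces the usual one
  on R^d.  Measurable means Lebesgue measurable.
\<close>

abbreviation Rvec :: "nat \<Rightarrow> (nat \<Rightarrow> real) set" where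
  "Rvec d \<equiv> topspace (Euclidean_space d)"

definition enorm :: "nat \<Rightarrow> (nat \<Rightarrow> real) \<Rightarrow> real" where
  "enorm d x = L2_set x {..<d}"

text \<open>
  Integrals of nonnegative integrands take values in \<^typ>\<open>ennreal\<close>, so infinite values
  are not lost.  At s = t the quotients below are 0 by the convention x / 0 = 0;
  this affects only a null set.
\<close>

definition alpha_functional :: "nat \<Rightarrow> real \<Rightarrow> (real \<Rightarrow> nat \<Rightarrow> real) \<Rightarrow> real \<Rightarrow> ennreal" where
  "alpha_functional d \<alpha> h t =
     ennreal (enorm d (h t)) +
     (\<integral>\<^sup>+ s\<in>{0..t}. ennreal (enorm d (\<lambda>i. h t i - h s i) / (t - s) powr (\<alpha> + 1)) \<partial>lebesgue)"

definition W0_norm :: "nat \<Rightarrow> real \<Rightarrow> real \<Rightarrow> (real \<Rightarrow> nat \<Rightarrow> real) \<Rightarrow> ennreal" where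
  "W0_norm d \<alpha> T h = (SUP t\<in>{0..T}. alpha_functional d \<alpha> h t)"

text \<open>Elements of this space are total functions; their values off [0,T] are irrelevant.\<close>

definition W0 :: "nat \<Rightarrow> real \<Rightarrow> real \<Rightarrow> (real \<Rightarrow> nat \<Rightarrow> real) set" where
  "W0 d \<alpha> T = {h. h \<in> {0..T} \<rightarrow> Rvec d \<and> h \<in> borel_measurable (lebesgue_on {0..T}) \<and>
                  W0_norm d \<alpha> T h < \<infinity>}"

definition F_int :: "(real \<times> real \<Rightarrow> nat \<Rightarrow> real) \<Rightarrow> real \<Rightarrow> nat \<Rightarrow> real" where
  "F_int f t = (\<lambda>i. LINT s:{0..t}|lebesgue. f (t, s) i)"

definition weighted_int :: "nat \<Rightarrow> real \<Rightarrow> (real \<times> real \<Rightarrow> nat \<Rightarrow> real) \<Rightarrow> real \<Rightarrow> ennreal" where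
  "weighted_int d \<alpha> f t =
     (\<integral>\<^sup>+ s\<in>{0..t}. ennreal (enorm d (f (t, s)) / (t - s) powr \<alpha>) \<partial>lebesgue)"

end

theory Submission
  imports Defs
begin

text \<open>
  Write \<open>F\<close> for the primitive and \<open>W(t)\<close> for the weighted integral at \<open>t\<close>. Everything follows from
  one inequality (\<open>increment_le\<close>): for \<open>s \<le> t\<close>, the difference \<open>F(t) - F(s)\<close> is the integral over
  \<open>[0,s]\<close> of \<open>f(t,r) - f(s,r)\<close>, which the Hoelder condition bounds by \<open>L s (t-s)^\<mu>\<close>, plus the
  integral over \<open>(s,t]\<close> of \<open>f(t,r)\<close>.

  Divide by \<open>(t-s)^(\<alpha>+1)\<close> and integrate in \<open>s\<close>. Since \<open>\<mu> > \<alpha>\<close>, the kernel \<open>(t-s)^(\<mu>-\<alpha>-1)\<close> is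
  integrable, and with \<open>s \<le> t\<close> the first part contributes at most
  \<open>L t \<cdot> t^(\<mu>-\<alpha>) / (\<mu>-\<alpha>)\<close>. In the second part the order of integration is exchanged
  (\<open>nn_integral_singular_tail_le\<close>): the inner integral becomes that of \<open>(t-s)^(-\<alpha>-1)\<close> over
  \<open>0 \<le> s < r\<close>, at most \<open>(t-r)^(-\<alpha>) / \<alpha>\<close>, so that part is at most \<open>W(t) / \<alpha>\<close>. Finally
  \<open>(t-r)^\<alpha> \<le> (t-s)^\<alpha>\<close> on \<open>(s,t]\<close> gives \<open>\<integral>\<^sub>s\<^sup>t |f(t,r)| dr \<le> (t-s)^\<alpha> W(t)\<close>
  (\<open>tail_le_weighted_int\<close>); for \<open>s = 0\<close> this is \<open>|F(t)| \<le> T^\<alpha> W(t)\<close>. Hence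
  \<open>C1 = T^\<alpha> + 1/\<alpha>\<close> and \<open>C2 = L / (\<mu>-\<alpha>)\<close>.

  Two measurability questions remain. Joint Lebesgue measurability of \<open>f\<close> makes only almost
  every section \<open>f(t,\<sqdot>)\<close> measurable; the Hoelder condition writes every section as a pointwise
  limit of measurable ones (\<open>section_measurable\<close>). And \<open>F\<close> is measurable because it is
  continuous: the same two estimates, with \<open>W\<close> bounded, give
  \<open>|F(t) - F(s)| \<le> L T |t-s|^\<mu> + (sup W) |t-s|^\<alpha>\<close>.
\<close>

section \<open>The Euclidean norm of an integral\<close>

lemma enorm_zero [simp]: "enorm d (\<lambda>i. 0) = 0"
  by (simp add: enorm_def L2_set_def)

lemma enorm_nonneg [simp]: "0 \<le> enorm d x"
  by (simp add: enorm_def)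

lemma component_le_enorm: "i < d \<Longrightarrow> \<bar>x i\<bar> \<le> enorm d x"
  unfolding enorm_def L2_set_def
  by (auto intro!: real_le_rsqrt member_le_sum[where f = "\<lambda>i. (x i)\<^sup>2"])

lemma enorm_measurable [measurable]:
  assumes "\<And>i. i < d \<Longrightarrow> (\<lambda>x. h x i) \<in> borel_measurable M"
  shows "(\<lambda>x. enorm d (h x)) \<in> borel_measurable M"
  unfolding enorm_def L2_set_def using assms by measurable

lemma enorm_le_sum: "enorm d x \<le> (\<Sum>i<d. \<bar>x i\<bar>)"
  unfolding enorm_def by (rule L2_set_le_sum_abs)

text \<open>
  Duality argument: with \<open>v\<close> the integral of \<open>h\<close>, the square \<open>|v|\<^sup>2\<close> is the integral of the inner
  product of \<open>v\<close> and \<open>h\<close>, so Cauchy-Schwarz bounds it by \<open>|v|\<close> times the integral of \<open>|h|\<close>.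
\<close>

lemma enorm_integral_le:
  assumes int: "\<And>i. i < d \<Longrightarrow> integrable M (\<lambda>x. h x i)"
  shows "ennreal (enorm d (\<lambda>i. LINT x|M. h x i)) \<le> (\<integral>\<^sup>+x. ennreal (enorm d (h x)) \<partial>M)"
proof -
  define v where "v i = (LINT x|M. h x i)" for i
  have m: "(\<lambda>x. enorm d (h x)) \<in> borel_measurable M"
    using int by (intro enorm_measurable) auto
  have I: "integrable M (\<lambda>x. enorm d (h x))"
  proof (rule Bochner_Integration.integrable_bound[OF _ m])
    show "integrable M (\<lambda>x. \<Sum>i<d. \<bar>h x i\<bar>)"
      using int by auto
    show "AE x in M. norm (enorm d (h x)) \<le> norm (\<Sum>i<d. \<bar>h x i\<bar>)"
      using enorm_le_sum[of d] by (auto intro!: AE_I2 simp: sum_nonneg)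
  qed
  have "enorm d v * enorm d v = (\<Sum>i<d. v i * v i)"
    by (simp add: enorm_def L2_set_def sum_nonneg power2_eq_square)
  also have "\<dots> = (LINT x|M. (\<Sum>i<d. v i * h x i))"
    using int by (subst Bochner_Integration.integral_sum) (auto simp: v_def)
  also have "\<dots> \<le> (LINT x|M. enorm d v * enorm d (h x))"
  proof (rule integral_mono)
    show "integrable M (\<lambda>x. \<Sum>i<d. v i * h x i)"
      using int by auto
    show "integrable M (\<lambda>x. enorm d v * enorm d (h x))"
      using I by auto
    fix x
    have "(\<Sum>i<d. v i * h x i) \<le> (\<Sum>i<d. \<bar>v i\<bar> * \<bar>h x i\<bar>)"
      by (intro sum_mono) (metis abs_ge_self abs_mult)
    also have "\<dots> \<le> enorm d v * enorm d (h x)"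
      unfolding enorm_def by (rule L2_set_mult_ineq)
    finally show "(\<Sum>i<d. v i * h x i) \<le> enorm d v * enorm d (h x)" .
  qed
  finally have *: "enorm d v * enorm d v \<le> enorm d v * (LINT x|M. enorm d (h x))"
    by simp
  have "enorm d v \<le> (LINT x|M. enorm d (h x))"
  proof (cases "enorm d v = 0")
    case False
    then show ?thesis
      using * enorm_nonneg[of d v] by (metis mult_le_cancel_left_pos order_le_less)
  qed (simp add: Bochner_Integration.integral_nonneg)
  then show ?thesis
    using I by (subst nn_integral_eq_integral) (auto simp: v_def[abs_def] ennreal_leI)
qed

section \<open>Singular kernels and the exchange of integrals\<close>

text \<open>
  Used with \<open>\<beta> = -\<alpha>\<close>, where the interval has to stop before the singularity at \<open>t\<close>, and with
  \<open>\<beta> = \<mu> - \<alpha> > 0\<close>, where it reaches \<open>t\<close> and the kernel may be unbounded. The fundamental theorem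
  is therefore applied in the form that needs the derivative only in the open interval.
\<close>

lemma nn_integral_powr_kernel:
  fixes a b t \<beta> :: real
  assumes "a \<le> b" "b \<le> t" "\<beta> \<noteq> 0" "b < t \<or> 0 < \<beta>"
  shows "(\<integral>\<^sup>+s\<in>{a..b}. ennreal ((t - s) powr (\<beta> - 1)) \<partial>lebesgue)
       = ennreal (((t - a) powr \<beta> - (t - b) powr \<beta>) / \<beta>)"
proof -
  have "((\<lambda>s. (t - s) powr (\<beta> - 1)) has_integral
          (- ((t - b) powr \<beta> / \<beta>) - - ((t - a) powr \<beta> / \<beta>))) {a..b}"
  proof (rule fundamental_theorem_of_calculus_interior[OF assms(1)])
    show "continuous_on {a..b} (\<lambda>s. - ((t - s) powr \<beta> / \<beta>))"
      using assms by (intro continuous_intros continuous_on_powr') auto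
    show "((\<lambda>s. - ((t - s) powr \<beta> / \<beta>)) has_vector_derivative (t - x) powr (\<beta> - 1)) (at x)"
      if "x \<in> {a<..<b}" for x
    proof -
      have "((\<lambda>s. - ((t - s) powr \<beta> / \<beta>)) has_real_derivative
              (t - x) powr (\<beta> - 1)) (at x)"
        using that assms
        by (intro derivative_eq_intros refl) auto
      then show ?thesis
        using assms by (simp add: has_real_derivative_iff_has_vector_derivative)
    qed
  qed
  then have I: "((\<lambda>s. (t - s) powr (\<beta> - 1)) has_integral ((t - a) powr \<beta> - (t - b) powr \<beta>) / \<beta>) {a..b}"
    by (simp add: diff_divide_distrib)
  show ?thesis
    using nn_integral_has_integral_lebesgue'[OF _ I] by (simp add: nn_integral_completion)
qed

lemma sigma_finite_lebesgue: "sigma_finite_measure (lebesgue :: 'a::euclidean_space measure)"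
proof
  obtain A :: "'a set set" where "countable A" "A \<subseteq> sets lborel" "\<Union>A = space lborel"
    "\<forall>a\<in>A. emeasure lborel a \<noteq> \<infinity>"
    using lborel.sigma_finite_countable by blast
  then show "\<exists>A::'a set set. countable A \<and> A \<subseteq> sets lebesgue \<and> \<Union> A = space lebesgue \<and>
      (\<forall>a\<in>A. emeasure lebesgue a \<noteq> \<infinity>)"
    by (intro exI[of _ A]) (auto simp: subset_eq)
qed

lemma ident_lebesgue: "(\<lambda>x::real. x) \<in> borel_measurable lebesgue"
  by (rule measurable_completion) simp

lemma interval_indicator_measurable [measurable]:
  "indicator {a..b} \<in> borel_measurable (lebesgue :: real measure)"
  "indicator {a<..b} \<in> borel_measurable (lebesgue :: real measure)"
  "indicator {a<..<b} \<in> borel_measurable (lebesgue :: real measure)"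
  by (rule measurable_completion, simp)+

lemma AE_lebesgue_neq: "AE r in lebesgue. r \<noteq> (t::real)"
  by (intro AE_completion AE_lborel_singleton)

lemma tail_integrand_measurable:
  fixes g :: "real \<Rightarrow> ennreal"
  assumes [measurable]: "g \<in> borel_measurable lebesgue"
  shows "(\<lambda>(r, s). g r * indicator {s<..t} r) \<in> borel_measurable (lebesgue \<Otimes>\<^sub>M lebesgue)"
proof -
  have [measurable]: "fst \<in> borel_measurable (lebesgue \<Otimes>\<^sub>M (lebesgue :: real measure) :: (real \<times> real) measure)"
    "snd \<in> borel_measurable ((lebesgue :: real measure) \<Otimes>\<^sub>M lebesgue :: (real \<times> real) measure)"
    using measurable_compose[OF measurable_fst ident_lebesgue]
      measurable_compose[OF measurable_snd ident_lebesgue] by auto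
  have "(\<lambda>(r, s). g r * indicator {s<..t} r)
      = (\<lambda>p. g (fst p) * indicator {p. snd p < fst p \<and> fst p \<le> t} p)"
    by (auto simp: indicator_def fun_eq_iff)
  also have "\<dots> \<in> borel_measurable (lebesgue \<Otimes>\<^sub>M lebesgue)"
    by measurable
  finally show ?thesis .
qed

lemma tail_integral_measurable:
  fixes g :: "real \<Rightarrow> ennreal"
  assumes "g \<in> borel_measurable lebesgue"
  shows "(\<lambda>s. \<integral>\<^sup>+r\<in>{s<..t}. g r \<partial>lebesgue) \<in> borel_measurable lebesgue"
proof -
  interpret sigma_finite_measure "lebesgue :: real measure"
    by (rule sigma_finite_lebesgue)
  define w where "w r s = g r * indicator {s<..t} r" for r s
  have [measurable]: "(\<lambda>(r, s). w r s) \<in> borel_measurable (lebesgue \<Otimes>\<^sub>M lebesgue)"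
    unfolding w_def by (rule tail_integrand_measurable[OF assms])
  show ?thesis
    unfolding w_def[symmetric] by measurable
qed

text \<open>
  Integrating first in \<open>s\<close>, over \<open>0 \<le> s < r\<close>, turns the non-integrable singularity
  \<open>(t-s)^(-\<alpha>-1)\<close> into \<open>((t-r)^(-\<alpha>) - t^(-\<alpha>)) / \<alpha>\<close>; the bound drops the term \<open>t^(-\<alpha>)\<close>.
\<close>

lemma nn_integral_singular_tail_le:
  fixes g :: "real \<Rightarrow> ennreal"
  assumes g[measurable]: "g \<in> borel_measurable lebesgue" and \<alpha>: "0 < \<alpha>"
  shows "(\<integral>\<^sup>+s\<in>{0..t}. (\<integral>\<^sup>+r\<in>{s<..t}. g r \<partial>lebesgue) * ennreal (1 / (t - s) powr (\<alpha> + 1)) \<partial>lebesgue)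
       \<le> ennreal (1 / \<alpha>) * (\<integral>\<^sup>+r\<in>{0..t}. g r * ennreal (1 / (t - r) powr \<alpha>) \<partial>lebesgue)"
    (is "?A \<le> _")
proof -
  interpret L: sigma_finite_measure "lebesgue :: real measure"
    by (rule sigma_finite_lebesgue)
  interpret P: pair_sigma_finite "lebesgue :: real measure" "lebesgue :: real measure" ..
  define w where "w r s = g r * indicator {s<..t} r" for r s
  define c where "c s = ennreal (1 / (t - s) powr (\<alpha> + 1)) * indicator {0..t} s" for s
  define k where "k r s = w r s * c s" for r s
  have cm[measurable]: "c \<in> borel_measurable lebesgue"
    unfolding c_def by (rule measurable_completion) measurable
  have em: "(\<lambda>s. ennreal ((t - s) powr (-\<alpha> - 1)) * indicator {0..r} s) \<in> borel_measurable lebesgue" for r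
    by (rule measurable_completion) measurable
  have "(\<lambda>r. ennreal (1 / (t - r) powr \<alpha>) * indicator {0..t} r) \<in> borel_measurable lebesgue"
    by (rule measurable_completion) measurable
  from borel_measurable_times_ennreal[OF g this]
  have qm: "(\<lambda>r. g r * ennreal (1 / (t - r) powr \<alpha>) * indicator {0..t} r) \<in> borel_measurable lebesgue"
    by (simp add: mult.assoc)
  have [measurable]: "(\<lambda>(r, s). w r s) \<in> borel_measurable (lebesgue \<Otimes>\<^sub>M lebesgue)"
    unfolding w_def by (rule tail_integrand_measurable[OF g])
  have km[measurable]: "(\<lambda>(r, s). k r s) \<in> borel_measurable (lebesgue \<Otimes>\<^sub>M lebesgue)"
    unfolding k_def by measurable
  have "?A = (\<integral>\<^sup>+s. \<integral>\<^sup>+r. k r s \<partial>lebesgue \<partial>lebesgue)"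
    unfolding k_def c_def w_def[symmetric]
    by (intro nn_integral_cong, subst nn_integral_multc) (auto simp: mult.assoc)
  also have "\<dots> = (\<integral>\<^sup>+r. \<integral>\<^sup>+s. k r s \<partial>lebesgue \<partial>lebesgue)"
    by (rule P.Fubini') simp
  also have "\<dots> \<le> (\<integral>\<^sup>+r. ennreal (1 / \<alpha>) * (g r * ennreal (1 / (t - r) powr \<alpha>) * indicator {0..t} r) \<partial>lebesgue)"
    \<comment> \<open>At \<open>r = t\<close> the inner integral may be infinite, while \<open>1 / 0\<close> on the right is \<open>0\<close>.\<close>
  proof (rule nn_integral_mono_AE, rule AE_mp[OF AE_lebesgue_neq[of t]], rule AE_I2, rule impI)
    fix r assume "r \<noteq> t"
    show "(\<integral>\<^sup>+s. k r s \<partial>lebesgue) \<le> ennreal (1 / \<alpha>) * (g r * ennreal (1 / (t - r) powr \<alpha>) * indicator {0..t} r)"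
    proof (cases "0 \<le> r \<and> r < t")
      case False
      then have "k r s = 0" for s
        using \<open>r \<noteq> t\<close> by (auto simp: k_def c_def w_def indicator_def)
      then show ?thesis by simp
    next
      case True
      have "(\<integral>\<^sup>+s. k r s \<partial>lebesgue)
          \<le> (\<integral>\<^sup>+s. g r * (ennreal ((t - s) powr (-\<alpha> - 1)) * indicator {0..r} s) \<partial>lebesgue)"
      proof (rule nn_integral_mono)
        fix s
        have e: "-\<alpha> - 1 = - (\<alpha> + 1)"
          by simp
        have "1 / (t - s) powr (\<alpha> + 1) = (t - s) powr (-\<alpha> - 1)"
          unfolding e by (rule powr_minus_divide[symmetric])
        then show "k r s \<le> g r * (ennreal ((t - s) powr (-\<alpha> - 1)) * indicator {0..r} s)"
          by (auto simp: k_def c_def w_def indicator_def)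
      qed
      also have "\<dots> = g r * ennreal ((t powr (-\<alpha>) - (t - r) powr (-\<alpha>)) / (-\<alpha>))"
        using nn_integral_powr_kernel[of 0 r t "-\<alpha>"] True \<alpha>
        by (subst nn_integral_cmult[OF em]) simp_all
      also have "\<dots> \<le> g r * ennreal (1 / \<alpha> * (1 / (t - r) powr \<alpha>))"
      proof (intro mult_left_mono ennreal_leI)
        have "(t powr (-\<alpha>) - (t - r) powr (-\<alpha>)) / (-\<alpha>) = 1 / \<alpha> * ((t - r) powr (-\<alpha>) - t powr (-\<alpha>))"
          by (simp add: minus_divide_left)
        also have "\<dots> \<le> 1 / \<alpha> * (t - r) powr (-\<alpha>)"
          using \<alpha> by (intro mult_left_mono) simp_all
        finally show "(t powr (-\<alpha>) - (t - r) powr (-\<alpha>)) / (-\<alpha>) \<le> 1 / \<alpha> * (1 / (t - r) powr \<alpha>)"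
          by (simp add: powr_minus_divide)
      qed simp
      also have "\<dots> = ennreal (1 / \<alpha>) * (g r * ennreal (1 / (t - r) powr \<alpha>) * indicator {0..t} r)"
        using \<alpha> True ennreal_mult[of "1 / \<alpha>" "1 / (t - r) powr \<alpha>"] by (simp only: mult_ac) simp
      finally show ?thesis .
    qed
  qed
  also have "\<dots> = ennreal (1 / \<alpha>) * (\<integral>\<^sup>+r\<in>{0..t}. g r * ennreal (1 / (t - r) powr \<alpha>) \<partial>lebesgue)"
    by (rule nn_integral_cmult[OF qm])
  finally show "?A \<le> ennreal (1 / \<alpha>) * (\<integral>\<^sup>+r\<in>{0..t}. g r * ennreal (1 / (t - r) powr \<alpha>) \<partial>lebesgue)" .
qed

section \<open>Sections of Lebesgue measurable functions\<close>

text \<open>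
  Sections of a Lebesgue measurable function need not be measurable, but a Borel function agrees
  with it off a null set of the plane, and almost every section of a null set is null.
\<close>

lemma AE_section_measurable:
  fixes f :: "real \<times> real \<Rightarrow> real"
  assumes "f \<in> borel_measurable lebesgue"
  shows "AE t in lebesgue. (\<lambda>s. f (t, s)) \<in> borel_measurable lebesgue"
proof -
  obtain f' where f'[measurable]: "f' \<in> borel_measurable borel" and eq: "AE x in lborel. f x = f' x"
    using completion_ex_borel_measurable_real[OF assms] by auto
  have "AE x in lborel \<Otimes>\<^sub>M lborel. f x = f' x"
    using eq unfolding lborel_prod .
  from lborel_pair.AE_pair[OF this]
  have "AE t in lborel. AE s in lborel. f (t, s) = f' (t, s)" .
  then have "AE t in lborel. (\<lambda>s. f (t, s)) \<in> borel_measurable lebesgue"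
  proof (rule eventually_mono)
    fix t assume ae: "AE s in lborel. f (t, s) = f' (t, s)"
    have "(\<lambda>s. f' (t, s)) \<in> borel_measurable (lborel :: real measure)"
      by measurable
    then have "(\<lambda>s. f' (t, s)) \<in> borel_measurable (lebesgue :: real measure)"
      by (rule measurable_completion)
    then show "(\<lambda>s. f (t, s)) \<in> borel_measurable lebesgue"
      by (rule borel_measurable_AE) (use AE_completion[OF ae] in \<open>auto elim: eventually_mono\<close>)
  qed
  then show ?thesis by (rule AE_completion)
qed

lemma AE_exists_in_interval:
  fixes a b :: real
  assumes "a < b" "AE t in lebesgue. P t"
  shows "\<exists>t. a < t \<and> t < b \<and> P t"
proof (rule ccontr)
  assume "\<not> ?thesis"
  then have "AE t in lebesgue. t \<notin> {a<..<b}"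
    using assms(2) by (auto elim: eventually_mono)
  then have "emeasure lebesgue {a<..<b} = 0"
    by (subst (asm) AE_iff_measurable[of "{a<..<b}"]) auto
  then show False
    using \<open>a < b\<close> by simp
qed

section \<open>The primitive of a Hoelder integrand\<close>

locale holder_integrand =
  fixes d :: nat and T \<alpha> L \<mu> :: real and f :: "real \<times> real \<Rightarrow> nat \<Rightarrow> real"
  assumes T: "0 < T" and \<alpha>: "0 < \<alpha>" and L: "0 \<le> L" and \<mu>: "\<alpha> < \<mu>"
    and f_Rvec: "f \<in> {0..T} \<times> {0..T} \<rightarrow> Rvec d"
    and f_measurable: "f \<in> borel_measurable (lebesgue_on ({0..T} \<times> {0..T}))"
    and holder: "\<And>s t1 t2. 0 < s \<Longrightarrow> s \<le> t1 \<Longrightarrow> t1 \<le> T \<Longrightarrow> s \<le> t2 \<Longrightarrow> t2 \<le> T \<Longrightarrow>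
         enorm d (\<lambda>i. f (t1, s) i - f (t2, s) i) \<le> L * \<bar>t1 - t2\<bar> powr \<mu>"
    and weighted_finite: "(SUP t\<in>{0..T}. weighted_int d \<alpha> f t) < \<infinity>"
begin

text \<open>
  Cutting \<open>f(t,\<sqdot>)\<close> off outside \<open>[0,t]\<close> turns values of \<open>F\<close> at different times into integrals over
  the same space, so that they can be subtracted under the integral sign.
\<close>

definition slice :: "real \<Rightarrow> real \<Rightarrow> nat \<Rightarrow> real" where
  "slice t s i = indicator {0..t} s * f (t, s) i"

lemma enorm_slice: "enorm d (slice t s) = indicator {0..t} s * enorm d (f (t, s))"
  by (auto simp: slice_def[abs_def] indicator_def)

lemma F_int_eq: "F_int f t i = (LINT s|lebesgue. slice t s i)"
  by (simp add: F_int_def set_lebesgue_integral_def slice_def)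

lemma f_coord_ge: "t \<in> {0..T} \<Longrightarrow> s \<in> {0..T} \<Longrightarrow> d \<le> i \<Longrightarrow> f (t, s) i = 0"
  using f_Rvec by (force simp: topspace_Euclidean_space Pi_iff)

lemma slice_coord_ge: "t \<in> {0..T} \<Longrightarrow> d \<le> i \<Longrightarrow> slice t s i = 0"
  using f_coord_ge[of t s i] by (auto simp: slice_def indicator_def)

text \<open>
  The times with a measurable section are dense, so there are such times \<open>\<tau>\<^sub>n\<close> increasing to \<open>t\<close>,
  and \<open>f(\<tau>\<^sub>n,s)\<close> tends to \<open>f(t,s)\<close> for \<open>0 < s < t\<close> by the Hoelder condition. Approximation from
  below also covers \<open>t = T\<close>; the condition then applies only once \<open>\<tau>\<^sub>n > s\<close>, hence the cut-off
  at \<open>\<tau>\<^sub>n\<close> in the approximants.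
\<close>

lemma section_measurable [measurable]:
  assumes t: "t \<in> {0..T}"
  shows "(\<lambda>s. slice t s i) \<in> borel_measurable lebesgue"
proof -
  have point: "(\<lambda>s. indicator {a} s * c) \<in> borel_measurable (lebesgue :: real measure)" for a c :: real
    by (rule measurable_completion[OF borel_measurable_times[OF borel_measurable_indicator borel_measurable_const]]) simp
  show ?thesis
  proof (cases "t = 0")
    case True
    then have eq: "(\<lambda>s. slice t s i) = (\<lambda>s. indicator {0} s * f (0, 0) i)"
      by (auto simp: slice_def indicator_def fun_eq_iff)
    show ?thesis
      unfolding eq by (rule point)
  next
    case False
    with t have "0 < t" "t \<le> T" by auto
    consider "i < d" | "d \<le> i" by linarith
    then show ?thesis
    proof cases
      case 2
      then show ?thesis
        using slice_coord_ge[OF t] by simp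
    next
      case 1
      define \<phi> where "\<phi> p = indicator ({0..T} \<times> {0..T}) p * f p i" for p
      have "(\<lambda>p. f p i) \<in> borel_measurable (lebesgue_on ({0..T} \<times> {0..T}))"
        using f_measurable by (rule measurable_product_then_coordinatewise)
      moreover have "{0..T} \<times> {0..T} \<inter> space lebesgue \<in> sets lebesgue"
        by (simp add: closed_Times borel_closed)
      ultimately have "\<phi> \<in> borel_measurable lebesgue"
        by (simp add: borel_measurable_restrict_space_iff \<phi>_def[abs_def])
      then have ae: "AE t in lebesgue. (\<lambda>s. \<phi> (t, s)) \<in> borel_measurable lebesgue"
        by (rule AE_section_measurable)
      have "\<exists>\<tau>. t - t / (real n + 1) < \<tau> \<and> \<tau> < t \<and> (\<lambda>s. \<phi> (\<tau>, s)) \<in> borel_measurable lebesgue" for n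
        using \<open>0 < t\<close> by (intro AE_exists_in_interval ae) auto
      then obtain \<tau> where \<tau>: "\<And>n. t - t / (real n + 1) < \<tau> n" "\<And>n. \<tau> n < t"
        and meas: "\<And>n. (\<lambda>s. \<phi> (\<tau> n, s)) \<in> borel_measurable lebesgue"
        by metis
      have lim: "\<tau> \<longlonglongrightarrow> t"
      proof (rule tendsto_sandwich[of "\<lambda>n. t - t / (real n + 1)" _ _ "\<lambda>n. t"])
        have "(\<lambda>n. t - t * inverse (real (Suc n))) \<longlonglongrightarrow> t - t * 0"
          by (intro tendsto_intros LIMSEQ_inverse_real_of_nat)
        then show "(\<lambda>n. t - t / (real n + 1)) \<longlonglongrightarrow> t"
          by (simp add: field_simps)
      qed (use \<tau> in \<open>auto intro!: eventuallyI less_imp_le\<close>)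
      define u where "u n s = indicator {0<..<\<tau> n} s * \<phi> (\<tau> n, s)" for n s
      have u_lim: "(\<lambda>n. u n s) \<longlonglongrightarrow> indicator {0<..<t} s * f (t, s) i" for s
      proof (cases "0 < s \<and> s < t")
        case False
        then have "u n s = 0" for n
          using \<tau>(2)[of n] by (auto simp: u_def indicator_def)
        then show ?thesis
          using False by (auto simp: indicator_def)
      next
        case True
        have "(\<lambda>n. L * \<bar>\<tau> n - t\<bar> powr \<mu>) \<longlonglongrightarrow> L * 0"
          using \<alpha> \<mu> lim
          by (intro tendsto_intros tendsto_zero_powrI[where b = \<mu>] tendsto_rabs_zero)
             (auto simp: LIM_zero_iff)
        moreover have "\<forall>\<^sub>F n in sequentially. norm (u n s - f (t, s) i) \<le> L * \<bar>\<tau> n - t\<bar> powr \<mu>"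
          using order_tendstoD(1)[OF lim True[THEN conjunct2]]
        proof (eventually_elim)
          case (elim n)
          have "u n s = f (\<tau> n, s) i"
            using elim True \<tau>(2)[of n] \<open>t \<le> T\<close> by (auto simp: u_def \<phi>_def)
          moreover have "\<bar>f (\<tau> n, s) i - f (t, s) i\<bar> \<le> enorm d (\<lambda>i. f (\<tau> n, s) i - f (t, s) i)"
            using component_le_enorm[OF 1, of "\<lambda>i. f (\<tau> n, s) i - f (t, s) i"] .
          moreover have "\<dots> \<le> L * \<bar>\<tau> n - t\<bar> powr \<mu>"
            using elim True \<tau>(2)[of n] \<open>t \<le> T\<close> by (intro holder) auto
          ultimately show ?case by simp
        qed
        ultimately have "(\<lambda>n. u n s - f (t, s) i) \<longlonglongrightarrow> 0"
          by (auto intro: Lim_null_comparison)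
        then show ?thesis
          using True by (simp add: LIM_zero_iff)
      qed
      have [measurable]: "(\<lambda>s. u n s) \<in> borel_measurable lebesgue" for n
        unfolding u_def using meas[of n] by measurable
      have inner: "(\<lambda>s. indicator {0<..<t} s * f (t, s) i) \<in> borel_measurable lebesgue"
        by (rule borel_measurable_LIMSEQ_real[OF u_lim]) measurable
      have "(\<lambda>s. slice t s i) = (\<lambda>s. indicator {0<..<t} s * f (t, s) i
          + indicator {0} s * f (t, 0) i + indicator {t} s * f (t, t) i)"
        using \<open>0 < t\<close> by (auto simp: slice_def indicator_def fun_eq_iff)
      also have "\<dots> \<in> borel_measurable lebesgue"
        by (intro borel_measurable_add inner point)
      finally show ?thesis .
    qed
  qed
qed

lemma enorm_section_measurable [measurable]:
  "t \<in> {0..T} \<Longrightarrow> (\<lambda>s. enorm d (slice t s)) \<in> borel_measurable lebesgue"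
  by (rule enorm_measurable) measurable

lemma weighted_int_eq:
  "weighted_int d \<alpha> f t = (\<integral>\<^sup>+s\<in>{0..t}. ennreal (enorm d (slice t s)) * ennreal (1 / (t - s) powr \<alpha>) \<partial>lebesgue)"
  unfolding weighted_int_def
  by (intro nn_integral_cong) (auto simp: enorm_slice indicator_def simp flip: ennreal_mult)

text \<open>
  The factor \<open>(t-s)^\<alpha>\<close> makes this a modulus of continuity for \<open>F\<close>, not only a bound on its size.
\<close>

lemma tail_le_weighted_int:
  assumes "0 \<le> s" "s \<le> t" "t \<le> T"
  shows "(\<integral>\<^sup>+r\<in>{s<..t}. ennreal (enorm d (slice t r)) \<partial>lebesgue)
       \<le> ennreal ((t - s) powr \<alpha>) * weighted_int d \<alpha> f t"
proof -
  have t: "t \<in> {0..T}" using assms by auto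
  have gm: "(\<lambda>r. ennreal (enorm d (slice t r))) \<in> borel_measurable lebesgue"
    using enorm_section_measurable[OF t] by simp
  have "(\<lambda>r. ennreal (1 / (t - r) powr \<alpha>) * indicator {0..t} r) \<in> borel_measurable lebesgue"
    by (rule measurable_completion) measurable
  from borel_measurable_times_ennreal[OF gm this]
  have qm: "(\<lambda>r. ennreal (enorm d (slice t r)) * ennreal (1 / (t - r) powr \<alpha>) * indicator {0..t} r)
      \<in> borel_measurable lebesgue"
    by (simp add: mult.assoc)
  have "(\<integral>\<^sup>+r\<in>{s<..t}. ennreal (enorm d (slice t r)) \<partial>lebesgue)
     \<le> (\<integral>\<^sup>+r. ennreal ((t - s) powr \<alpha>)
          * (ennreal (enorm d (slice t r)) * ennreal (1 / (t - r) powr \<alpha>) * indicator {0..t} r) \<partial>lebesgue)"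
  proof (rule nn_integral_mono_AE, rule AE_mp[OF AE_lebesgue_neq[of t]], rule AE_I2, rule impI)
    fix r assume "r \<noteq> t"
    show "ennreal (enorm d (slice t r)) * indicator {s<..t} r
       \<le> ennreal ((t - s) powr \<alpha>)
          * (ennreal (enorm d (slice t r)) * ennreal (1 / (t - r) powr \<alpha>) * indicator {0..t} r)"
    proof (cases "s < r \<and> r < t")
      case True
      have "(t - r) powr \<alpha> \<le> (t - s) powr \<alpha>"
        using True \<alpha> by (intro powr_mono2) auto
      moreover have "0 < (t - r) powr \<alpha>"
        using True by simp
      ultimately have "enorm d (slice t r) * 1 \<le> enorm d (slice t r) * ((t - s) powr \<alpha> * (1 / (t - r) powr \<alpha>))"
        by (intro mult_left_mono) (auto simp: field_simps)
      then show ?thesis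
        using True assms by (auto simp: mult_ac simp flip: ennreal_mult intro!: ennreal_leI)
    qed (use \<open>r \<noteq> t\<close> in auto)
  qed
  also have "\<dots> = ennreal ((t - s) powr \<alpha>) * weighted_int d \<alpha> f t"
    unfolding weighted_int_eq by (rule nn_integral_cmult[OF qm])
  finally show ?thesis .
qed

lemma weighted_int_le_SUP: "t \<in> {0..T} \<Longrightarrow> weighted_int d \<alpha> f t \<le> (SUP t\<in>{0..T}. weighted_int d \<alpha> f t)"
  by (rule SUP_upper)

lemma integrable_section:
  assumes t: "t \<in> {0..T}"
  shows "integrable lebesgue (\<lambda>s. slice t s i)"
proof (cases "i < d")
  case True
  show ?thesis
  proof (rule integrableI_bounded)
    have "(\<integral>\<^sup>+s. ennreal (norm (slice t s i)) \<partial>lebesgue)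
        \<le> (\<integral>\<^sup>+r\<in>{0<..t}. ennreal (enorm d (slice t r)) \<partial>lebesgue)"
    proof (rule nn_integral_mono_AE, rule AE_mp[OF AE_lebesgue_neq[of 0]], rule AE_I2, rule impI)
      fix r :: real assume "r \<noteq> 0"
      show "ennreal (norm (slice t r i)) \<le> ennreal (enorm d (slice t r)) * indicator {0<..t} r"
      proof (cases "0 < r \<and> r \<le> t")
        case True
        then show ?thesis
          using component_le_enorm[OF \<open>i < d\<close>, of "slice t r"] by (auto intro!: ennreal_leI)
      qed (use \<open>r \<noteq> 0\<close> in \<open>auto simp: slice_def\<close>)
    qed
    also have "\<dots> \<le> ennreal ((t - 0) powr \<alpha>) * weighted_int d \<alpha> f t"
      using t by (intro tail_le_weighted_int) auto
    also have "\<dots> < \<infinity>"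
      using weighted_int_le_SUP[OF t] weighted_finite by (auto simp: ennreal_mult_less_top)
    finally show "(\<integral>\<^sup>+s. ennreal (norm (slice t s i)) \<partial>lebesgue) < \<infinity>" .
  qed (rule section_measurable[OF t])
qed (use slice_coord_ge[OF t] in simp)

text \<open>
  On \<open>[0,s]\<close> the two integrands are compared by the Hoelder condition, which excludes the null
  set \<open>r = 0\<close>; on \<open>(s,t]\<close> only \<open>f(t,\<sqdot>)\<close> is left.
\<close>

lemma increment_le:
  assumes "0 \<le> s" "s \<le> t" "t \<le> T"
  shows "ennreal (enorm d (\<lambda>i. F_int f t i - F_int f s i))
       \<le> ennreal (L * s * (t - s) powr \<mu>) + (\<integral>\<^sup>+r\<in>{s<..t}. ennreal (enorm d (slice t r)) \<partial>lebesgue)"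
proof -
  have t: "t \<in> {0..T}" and s: "s \<in> {0..T}" using assms by auto
  have gm: "(\<lambda>r. ennreal (enorm d (slice t r))) \<in> borel_measurable lebesgue"
    using enorm_section_measurable[OF t] by simp
  have "(\<lambda>i. F_int f t i - F_int f s i) = (\<lambda>i. LINT r|lebesgue. slice t r i - slice s r i)"
    unfolding F_int_eq
    by (intro ext Bochner_Integration.integral_diff[symmetric] integrable_section t s)
  then have "ennreal (enorm d (\<lambda>i. F_int f t i - F_int f s i))
      \<le> (\<integral>\<^sup>+r. ennreal (enorm d (\<lambda>i. slice t r i - slice s r i)) \<partial>lebesgue)"
    using enorm_integral_le[of d lebesgue "\<lambda>r i. slice t r i - slice s r i"]
      Bochner_Integration.integrable_diff[OF integrable_section[OF t] integrable_section[OF s]]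
    by simp
  also have "\<dots> \<le> (\<integral>\<^sup>+r. ennreal (L * (t - s) powr \<mu>) * indicator {0..s} r
                        + ennreal (enorm d (slice t r)) * indicator {s<..t} r \<partial>lebesgue)"
  proof (rule nn_integral_mono_AE, rule AE_mp[OF AE_lebesgue_neq[of 0]], rule AE_I2, rule impI)
    fix r :: real assume "r \<noteq> 0"
    then consider "r < 0 \<or> t < r" | "0 < r" "r \<le> s" | "s < r" "r \<le> t"
      by linarith
    then show "ennreal (enorm d (\<lambda>i. slice t r i - slice s r i))
        \<le> ennreal (L * (t - s) powr \<mu>) * indicator {0..s} r + ennreal (enorm d (slice t r)) * indicator {s<..t} r"
    proof cases
      case 1
      then have "slice t r = (\<lambda>i. 0)" "slice s r = (\<lambda>i. 0)"
        using assms by (auto simp: slice_def)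
      then show ?thesis by simp
    next
      case 2
      then have "(\<lambda>i. slice t r i - slice s r i) = (\<lambda>i. f (t, r) i - f (s, r) i)"
        using assms by (auto simp: slice_def)
      then show ?thesis
        using holder[of r t s] 2 assms by (auto intro!: ennreal_leI)
    next
      case 3
      then have "(\<lambda>i. slice t r i - slice s r i) = slice t r"
        using assms by (auto simp: slice_def)
      then show ?thesis
        using 3 by auto
    qed
  qed
  also have "\<dots> = ennreal (L * (t - s) powr \<mu>) * emeasure lebesgue {0..s}
                + (\<integral>\<^sup>+r\<in>{s<..t}. ennreal (enorm d (slice t r)) \<partial>lebesgue)"
    using gm by (subst nn_integral_add) (simp_all add: nn_integral_cmult_indicator)
  also have "ennreal (L * (t - s) powr \<mu>) * emeasure lebesgue {0..s} = ennreal (L * s * (t - s) powr \<mu>)"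
    using assms L by (simp add: mult_ac flip: ennreal_mult)
  finally show ?thesis .
qed

lemma F_int_0: "F_int f 0 i = 0"
proof -
  have "AE s in lebesgue. slice 0 s i = 0"
    by (rule AE_mp[OF AE_lebesgue_neq[of 0]]) (simp add: slice_def)
  then show ?thesis
    unfolding F_int_eq by (rule integral_eq_zero_AE)
qed

lemma enorm_F_int_le:
  assumes "t \<in> {0..T}"
  shows "ennreal (enorm d (F_int f t)) \<le> ennreal (t powr \<alpha>) * weighted_int d \<alpha> f t"
  using increment_le[of 0 t] tail_le_weighted_int[of 0 t] assms by (simp add: F_int_0)

text \<open>
  Both terms of \<open>increment_le\<close> are integrated against \<open>(t-s)^(-\<alpha>-1)\<close>: the Hoelder term leaves an
  integrable power of \<open>t-s\<close>, and the tail integral \<open>J\<close> is handled by exchanging integrals.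
\<close>

lemma alpha_functional_le:
  assumes t: "t \<in> {0..T}"
  shows "alpha_functional d \<alpha> (F_int f) t
       \<le> ennreal (T powr \<alpha> + 1 / \<alpha>) * weighted_int d \<alpha> f t
         + ennreal (L / (\<mu> - \<alpha>) * t powr (1 + \<mu> - \<alpha>))"
proof -
  let ?W = "weighted_int d \<alpha> f t"
  define J where "J s = (\<integral>\<^sup>+r\<in>{s<..t}. ennreal (enorm d (slice t r)) \<partial>lebesgue)" for s
  have gm: "(\<lambda>r. ennreal (enorm d (slice t r))) \<in> borel_measurable lebesgue"
    using enorm_section_measurable[OF t] by simp
  have Jm: "J \<in> borel_measurable lebesgue"
    unfolding J_def by (rule tail_integral_measurable[OF gm])
  have km: "(\<lambda>s. ennreal ((t - s) powr (\<mu> - \<alpha> - 1)) * indicator {0..t} s) \<in> borel_measurable lebesgue"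
    by (rule measurable_completion) measurable
  have "(\<lambda>s. ennreal (1 / (t - s) powr (\<alpha> + 1)) * indicator {0..t} s) \<in> borel_measurable lebesgue"
    by (rule measurable_completion) measurable
  from borel_measurable_times_ennreal[OF Jm this]
  have Jkm: "(\<lambda>s. J s * ennreal (1 / (t - s) powr (\<alpha> + 1)) * indicator {0..t} s) \<in> borel_measurable lebesgue"
    by (simp add: mult.assoc)
  have "(\<integral>\<^sup>+s\<in>{0..t}. ennreal (enorm d (\<lambda>i. F_int f t i - F_int f s i) / (t - s) powr (\<alpha> + 1)) \<partial>lebesgue)
      \<le> (\<integral>\<^sup>+s. ennreal (L * t) * (ennreal ((t - s) powr (\<mu> - \<alpha> - 1)) * indicator {0..t} s)
            + J s * ennreal (1 / (t - s) powr (\<alpha> + 1)) * indicator {0..t} s \<partial>lebesgue)"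
  proof (rule nn_integral_mono)
    fix s
    show "ennreal (enorm d (\<lambda>i. F_int f t i - F_int f s i) / (t - s) powr (\<alpha> + 1)) * indicator {0..t} s
       \<le> ennreal (L * t) * (ennreal ((t - s) powr (\<mu> - \<alpha> - 1)) * indicator {0..t} s)
            + J s * ennreal (1 / (t - s) powr (\<alpha> + 1)) * indicator {0..t} s"
    proof (cases "s \<in> {0..t}")
      case True
      let ?k = "1 / (t - s) powr (\<alpha> + 1)"
      have "ennreal (enorm d (\<lambda>i. F_int f t i - F_int f s i) / (t - s) powr (\<alpha> + 1))
          = ennreal (enorm d (\<lambda>i. F_int f t i - F_int f s i)) * ennreal ?k"
        by (simp flip: ennreal_mult)
      also have "\<dots> \<le> (ennreal (L * s * (t - s) powr \<mu>) + J s) * ennreal ?k"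
        unfolding J_def using True t by (intro mult_right_mono increment_le) auto
      also have "\<dots> = ennreal (L * s * ((t - s) powr \<mu> * ?k)) + J s * ennreal ?k"
        using True L by (simp add: distrib_right mult.assoc flip: ennreal_mult)
      also have "(t - s) powr \<mu> * ?k = (t - s) powr (\<mu> - \<alpha> - 1)"
        by (simp add: diff_diff_eq powr_diff)
      also have "ennreal (L * s * (t - s) powr (\<mu> - \<alpha> - 1)) \<le> ennreal (L * t * (t - s) powr (\<mu> - \<alpha> - 1))"
        using True L by (intro ennreal_leI mult_right_mono mult_left_mono) auto
      finally show ?thesis
        using True L by (simp add: ennreal_mult)
    qed simp
  qed
  also have "\<dots> = ennreal (L * t) * (\<integral>\<^sup>+s\<in>{0..t}. ennreal ((t - s) powr (\<mu> - \<alpha> - 1)) \<partial>lebesgue)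
      + (\<integral>\<^sup>+s\<in>{0..t}. J s * ennreal (1 / (t - s) powr (\<alpha> + 1)) \<partial>lebesgue)"
    using km Jkm by (subst nn_integral_add) (auto simp: nn_integral_cmult)
  also have "\<dots> \<le> ennreal (L / (\<mu> - \<alpha>) * t powr (1 + \<mu> - \<alpha>)) + ennreal (1 / \<alpha>) * ?W"
  proof (rule add_mono)
    have "t * t powr (\<mu> - \<alpha>) = t powr (1 + \<mu> - \<alpha>)"
      using t by (simp add: powr_mult_base add_diff_eq)
    then have eq: "L * t * (t powr (\<mu> - \<alpha>) / (\<mu> - \<alpha>)) = L / (\<mu> - \<alpha>) * t powr (1 + \<mu> - \<alpha>)"
      by (simp add: mult.assoc)
    have int: "(\<integral>\<^sup>+s\<in>{0..t}. ennreal ((t - s) powr (\<mu> - \<alpha> - 1)) \<partial>lebesgue) = ennreal (t powr (\<mu> - \<alpha>) / (\<mu> - \<alpha>))"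
      using nn_integral_powr_kernel[of 0 t t "\<mu> - \<alpha>"] t \<mu> by simp
    show "ennreal (L * t) * (\<integral>\<^sup>+s\<in>{0..t}. ennreal ((t - s) powr (\<mu> - \<alpha> - 1)) \<partial>lebesgue)
        \<le> ennreal (L / (\<mu> - \<alpha>) * t powr (1 + \<mu> - \<alpha>))"
      unfolding int eq[symmetric] using t \<mu> L by (subst ennreal_mult[of "L * t"]) simp_all
    show "(\<integral>\<^sup>+s\<in>{0..t}. J s * ennreal (1 / (t - s) powr (\<alpha> + 1)) \<partial>lebesgue) \<le> ennreal (1 / \<alpha>) * ?W"
      unfolding J_def weighted_int_eq by (rule nn_integral_singular_tail_le[OF gm \<alpha>])
  qed
  finally have sing: "(\<integral>\<^sup>+s\<in>{0..t}. ennreal (enorm d (\<lambda>i. F_int f t i - F_int f s i) / (t - s) powr (\<alpha> + 1)) \<partial>lebesgue)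
      \<le> ennreal (L / (\<mu> - \<alpha>) * t powr (1 + \<mu> - \<alpha>)) + ennreal (1 / \<alpha>) * ?W" .
  have "ennreal (enorm d (F_int f t)) \<le> ennreal (t powr \<alpha>) * ?W"
    by (rule enorm_F_int_le[OF t])
  also have "\<dots> \<le> ennreal (T powr \<alpha>) * ?W"
    using t \<alpha> by (intro mult_right_mono ennreal_leI powr_mono2) auto
  finally have "alpha_functional d \<alpha> (F_int f) t
      \<le> ennreal (T powr \<alpha>) * ?W + (ennreal (L / (\<mu> - \<alpha>) * t powr (1 + \<mu> - \<alpha>)) + ennreal (1 / \<alpha>) * ?W)"
    unfolding alpha_functional_def using sing by (intro add_mono) auto
  also have "\<dots> = ennreal (T powr \<alpha> + 1 / \<alpha>) * ?W + ennreal (L / (\<mu> - \<alpha>) * t powr (1 + \<mu> - \<alpha>))"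
    using \<alpha> by (simp add: ennreal_plus distrib_right add_ac)
  finally show ?thesis .
qed

text \<open>
  The finite supremum makes the bound of \<open>tail_le_weighted_int\<close> uniform in \<open>t\<close>, so \<open>F\<close> is even
  Hoelder continuous.
\<close>

lemma continuous_on_F_int: "continuous_on {0..T} (\<lambda>t. F_int f t i)"
proof (cases "i < d")
  case False
  then have "F_int f t i = 0" if "t \<in> {0..T}" for t
    using slice_coord_ge[OF that] by (simp add: F_int_eq)
  then show ?thesis
    by (auto intro!: continuous_on_eq[OF continuous_on_const[of _ 0]])
next
  case True
  define M where "M = enn2real (SUP t\<in>{0..T}. weighted_int d \<alpha> f t)"
  have M0: "0 \<le> M"
    by (simp add: M_def)
  have W: "weighted_int d \<alpha> f t \<le> ennreal M" if "t \<in> {0..T}" for t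
    using weighted_int_le_SUP[OF that] weighted_finite by (simp add: M_def)
  have incr: "\<bar>F_int f t i - F_int f s i\<bar> \<le> L * T * \<bar>t - s\<bar> powr \<mu> + \<bar>t - s\<bar> powr \<alpha> * M"
    if "s \<in> {0..T}" "t \<in> {0..T}" "s \<le> t" for s t
  proof -
    have "ennreal \<bar>F_int f t i - F_int f s i\<bar> \<le> ennreal (enorm d (\<lambda>i. F_int f t i - F_int f s i))"
      using component_le_enorm[OF True, of "\<lambda>i. F_int f t i - F_int f s i"] by (rule ennreal_leI)
    also have "\<dots> \<le> ennreal (L * s * (t - s) powr \<mu>) + (\<integral>\<^sup>+r\<in>{s<..t}. ennreal (enorm d (slice t r)) \<partial>lebesgue)"
      using that by (intro increment_le) auto
    also have "\<dots> \<le> ennreal (L * T * (t - s) powr \<mu>) + ennreal ((t - s) powr \<alpha>) * ennreal M"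
      using that L
      by (intro add_mono ennreal_leI mult_right_mono mult_left_mono
            order_trans[OF tail_le_weighted_int] W) auto
    also have "\<dots> = ennreal (L * T * \<bar>t - s\<bar> powr \<mu> + \<bar>t - s\<bar> powr \<alpha> * M)"
      using that L T by (simp add: M0 flip: ennreal_mult ennreal_plus)
    finally show ?thesis
      using L T M0 by (subst (asm) ennreal_le_iff) simp_all
  qed
  have "((\<lambda>s. F_int f s i) \<longlongrightarrow> F_int f t i) (at t within {0..T})" if t: "t \<in> {0..T}" for t
  proof -
    have "((\<lambda>s. L * T * \<bar>t - s\<bar> powr \<mu> + \<bar>t - s\<bar> powr \<alpha> * M) \<longlongrightarrow> L * T * 0 + 0 * M) (at t within {0..T})"
    proof -
      have "((\<lambda>s. \<bar>t - s\<bar>) \<longlongrightarrow> \<bar>t - t\<bar>) (at t within {0..T})"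
        by (intro tendsto_intros)
      then show ?thesis
        using \<alpha> \<mu> by (intro tendsto_intros tendsto_zero_powrI[where b = \<mu>] tendsto_zero_powrI[where b = \<alpha>]) auto
    qed
    moreover have "\<forall>\<^sub>F s in at t within {0..T}.
        norm (F_int f s i - F_int f t i) \<le> L * T * \<bar>t - s\<bar> powr \<mu> + \<bar>t - s\<bar> powr \<alpha> * M"
      unfolding eventually_at_filter
    proof (intro always_eventually allI impI)
      fix s assume "s \<in> {0..T}"
      then show "norm (F_int f s i - F_int f t i) \<le> L * T * \<bar>t - s\<bar> powr \<mu> + \<bar>t - s\<bar> powr \<alpha> * M"
        using incr[of s t] incr[of t s] t by (cases "s \<le> t") (auto simp: abs_minus_commute)
    qed
    ultimately have "((\<lambda>s. F_int f s i - F_int f t i) \<longlongrightarrow> 0) (at t within {0..T})"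
      by (auto intro: Lim_null_comparison)
    then show ?thesis
      by (simp add: LIM_zero_iff)
  qed
  then show ?thesis
    by (simp add: continuous_on_def)
qed

lemma F_int_in_W0: "F_int f \<in> W0 d \<alpha> T"
proof -
  have "F_int f t \<in> Rvec d" if "t \<in> {0..T}" for t
    using slice_coord_ge[OF that] by (simp add: topspace_Euclidean_space F_int_eq)
  moreover have "F_int f \<in> borel_measurable (lebesgue_on {0..T})"
    by (intro measurable_coordinatewise_then_product continuous_imp_measurable_on_sets_lebesgue
          continuous_on_F_int) auto
  moreover have "W0_norm d \<alpha> T (F_int f)
      \<le> ennreal (T powr \<alpha> + 1 / \<alpha>) * (SUP t\<in>{0..T}. weighted_int d \<alpha> f t)
        + ennreal (L / (\<mu> - \<alpha>) * T powr (1 + \<mu> - \<alpha>))"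
    unfolding W0_norm_def
    using \<mu> L
    by (intro SUP_least order_trans[OF alpha_functional_le] add_mono mult_left_mono
          weighted_int_le_SUP ennreal_leI powr_mono2) auto
  then have "W0_norm d \<alpha> T (F_int f) < \<infinity>"
    using weighted_finite by (auto simp: ennreal_mult_less_top intro: order_le_less_trans)
  ultimately show ?thesis
    by (simp add: W0_def)
qed

end

theorem proposition2p1:
  shows "\<exists>(C1 :: real \<Rightarrow> real \<Rightarrow> real) (C2 :: real \<Rightarrow> real \<Rightarrow> real \<Rightarrow> real).
    (\<forall>\<alpha> T. 0 \<le> C1 \<alpha> T) \<and> (\<forall>\<alpha> L \<mu>. 0 \<le> C2 \<alpha> L \<mu>) \<and>
    (\<forall>(d :: nat) (T :: real) (\<alpha> :: real) (L :: real) (\<mu> :: real)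
        (f :: real \<times> real \<Rightarrow> nat \<Rightarrow> real).
      0 < T \<and> 0 < \<alpha> \<and> \<alpha> < 1 / 2 \<and> 0 < L \<and> \<alpha> < \<mu> \<and>
      f \<in> {0..T} \<times> {0..T} \<rightarrow> Rvec d \<and>
      f \<in> borel_measurable (lebesgue_on ({0..T} \<times> {0..T})) \<and>
      (\<forall>s t1 t2. 0 < s \<and> s \<le> t1 \<and> t1 \<le> T \<and> s \<le> t2 \<and> t2 \<le> T \<longrightarrow>
         enorm d (\<lambda>i. f (t1, s) i - f (t2, s) i) \<le> L * \<bar>t1 - t2\<bar> powr \<mu>) \<and>
      (SUP t\<in>{0..T}. weighted_int d \<alpha> f t) < \<infinity>
      \<longrightarrow>
      F_int f \<in> W0 d \<alpha> T \<and>
      (\<forall>t\<in>{0..T}. alpha_functional d \<alpha> (F_int f) t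
         \<le> ennreal (C1 \<alpha> T) * weighted_int d \<alpha> f t
           + ennreal (C2 \<alpha> L \<mu> * t powr (1 + \<mu> - \<alpha>))))"
proof -
  have "F_int f \<in> W0 d \<alpha> T \<and>
      (\<forall>t\<in>{0..T}. alpha_functional d \<alpha> (F_int f) t
         \<le> ennreal (T powr \<alpha> + 1 / \<bar>\<alpha>\<bar>) * weighted_int d \<alpha> f t
           + ennreal (\<bar>L / (\<mu> - \<alpha>)\<bar> * t powr (1 + \<mu> - \<alpha>)))"
    if "0 < T \<and> 0 < \<alpha> \<and> \<alpha> < 1 / 2 \<and> 0 < L \<and> \<alpha> < \<mu> \<and>
      f \<in> {0..T} \<times> {0..T} \<rightarrow> Rvec d \<and>
      f \<in> borel_measurable (lebesgue_on ({0..T} \<times> {0..T})) \<and>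
      (\<forall>s t1 t2. 0 < s \<and> s \<le> t1 \<and> t1 \<le> T \<and> s \<le> t2 \<and> t2 \<le> T \<longrightarrow>
         enorm d (\<lambda>i. f (t1, s) i - f (t2, s) i) \<le> L * \<bar>t1 - t2\<bar> powr \<mu>) \<and>
      (SUP t\<in>{0..T}. weighted_int d \<alpha> f t) < \<infinity>"
    for d T \<alpha> L \<mu> f
  proof -
    interpret holder_integrand d T \<alpha> L \<mu> f
      using that by unfold_locales auto
    show ?thesis
      using F_int_in_W0 alpha_functional_le \<alpha> L \<mu> by simp
  qed
  \<comment> \<open>The absolute values make the constants nonnegative for parameters outside the range too.\<close>
  then show ?thesis
    by (intro exI[of _ "\<lambda>\<alpha> T. T powr \<alpha> + 1 / \<bar>\<alpha>\<bar>"] exI[of _ "\<lambda>\<alpha> L \<mu>. \<bar>L / (\<mu> - \<alpha>)\<bar>"]) auto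
qed

end
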